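(* Let $D$ be an $n\times n$ doubly stochastic matrix and let $p$ be a positive integer. Then $D$ is cyclic of order $p$ if and only if there exist an $n\times n$ permutation matrix $P$ and positive integers $r$ and $h_i,k_i$, $1\leq i \leq r$, satisfying $p=\operatorname{LCM}(h_1,h_2,\dots,h_r)$ and $h_1k_1 + h_2k_2 + \cdots + h_r k_r =n$, such that \[ P^{\intercal}DP = \bigoplus_{j=1}^r \left( K_{h_j} \otimes J_{k_j} \right). \] In that case, $D$ has $r$ eigenvalues equal to $1$ (counted with multiplicity) and $h(D)=h_1+h_2+\cdots+h_r$.
   Context: A square matrix is doubly stochastic if its entries are nonnegative reals and each row and column sums to $1$. A matrix $A$ is cyclic of order $p$ if $p$ is a positive integer with $A^{p+1}=A$ and $A^{m+1}\neq A$ for all $1\leq m<p$. For a square matrix $A$, $h(A)$ is the number of eigenvalues of $A$ of modulus equal to the spectral radius $\rho(A)$, counted with multiplicity; for doubly stochastic $D$ one has $\rho(D)=1$. $J_k$ is the $k\times k$ matrix with all entries $1/k$, $\oplus$ denotes the block-diagonal direct sum, and $A\otimes B$ is the Kronecker product, i.e. the block matrix with blocks $a_{ij}B$. $K_h$ is the $h\times h$ circular shift matrix, with entry $1$ in positions $(i,i+1)$ for $1\le i\le h-1$ and in position $(h,1)$, and $0$ elsewhere ($K_1=[1]$). LCM denotes the least common multiple. *)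

theory Defs
  imports "Jordan_Normal_Form.Spectral_Radius" "HOL-Combinatorics.Permutations"
begin

text \<open>
  Matrices are the variable-dimension matrices of the entry Jordan Normal Form, so rows and
  columns are indexed from 0.
\<close>

definition doubly_stochastic :: "real mat \<Rightarrow> bool" where
  "doubly_stochastic A \<longleftrightarrow> square_mat A \<and>
     (\<forall>i<dim_row A. \<forall>j<dim_col A. 0 \<le> A $$ (i, j)) \<and>
     (\<forall>i<dim_row A. (\<Sum>j<dim_col A. A $$ (i, j)) = 1) \<and>
     (\<forall>j<dim_col A. (\<Sum>i<dim_row A. A $$ (i, j)) = 1)"

definition cyclic_of_order :: "'a::semiring_1 mat \<Rightarrow> nat \<Rightarrow> bool" where
  "cyclic_of_order A p \<longleftrightarrow> square_mat A \<and> 0 < p \<and> A ^\<^sub>m (p + 1) = A \<and>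
     (\<forall>m. 1 \<le> m \<and> m < p \<longrightarrow> A ^\<^sub>m (m + 1) \<noteq> A)"

definition permutation_mat :: "nat \<Rightarrow> real mat \<Rightarrow> bool" where
  "permutation_mat n P \<longleftrightarrow>
     (\<exists>\<sigma>. \<sigma> permutes {..<n} \<and> P = mat n n (\<lambda>(i, j). if j = \<sigma> i then 1 else 0))"

definition J_mat :: "nat \<Rightarrow> real mat" where
  "J_mat k = mat k k (\<lambda>_. 1 / real k)"

definition K_mat :: "nat \<Rightarrow> real mat" where
  "K_mat h = mat h h (\<lambda>(i, j). if j = (i + 1) mod h then 1 else 0)"

definition kronecker_mat :: "'a::times mat \<Rightarrow> 'a mat \<Rightarrow> 'a mat" where
  "kronecker_mat A B = mat (dim_row A * dim_row B) (dim_col A * dim_col B)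
     (\<lambda>(i, j). A $$ (i div dim_row B, j div dim_col B) * B $$ (i mod dim_row B, j mod dim_col B))"

text \<open>Eigenvalues are counted with algebraic multiplicity.\<close>

definition alg_multiplicity :: "complex mat \<Rightarrow> complex \<Rightarrow> nat" where
  "alg_multiplicity A z = Polynomial.order z (char_poly A)"

definition num_peripheral_eigenvalues :: "complex mat \<Rightarrow> nat" where
  "num_peripheral_eigenvalues A =
     (\<Sum>z \<in> {z \<in> spectrum A. cmod z = spectral_radius A}. alg_multiplicity A z)"

definition cyclic_block_form ::
    "nat \<Rightarrow> real mat \<Rightarrow> nat \<Rightarrow> real mat \<Rightarrow> nat \<Rightarrow> (nat \<Rightarrow> nat) \<Rightarrow> (nat \<Rightarrow> nat) \<Rightarrow> bool" where
  "cyclic_block_form n D p P r h k \<longleftrightarrow>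
     permutation_mat n P \<and> 0 < r \<and> (\<forall>i\<in>{1..r}. 0 < h i \<and> 0 < k i) \<and>
     p = Lcm (h ` {1..r}) \<and> (\<Sum>i=1..r. h i * k i) = n \<and>
     transpose_mat P * D * P =
       diag_block_mat (map (\<lambda>j. kronecker_mat (K_mat (h j)) (J_mat (k j))) [1..<r + 1])"

end

theory Submission
  imports Defs "HOL-Combinatorics.Orbits" "HOL-Number_Theory.Cong"
begin

text \<open>
  If \<open>D ^ (p + 1) = D\<close>, then \<open>E = D ^ p\<close> is an idempotent doubly stochastic matrix that fixes \<open>D\<close> on
  both sides. Every vector fixed by such an \<open>E\<close> is constant on the classes of the relation
  \<open>E i j > 0\<close>, which is therefore an equivalence relation. As \<open>D\<close> is invertible relative to \<open>E\<close> with
  the nonnegative inverse \<open>D ^ (2p - 1)\<close>, it permutes these classes, preserving their sizes, and the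
  cycles of that permutation are the blocks \<open>K \<otimes> J\<close>. Conversely, the powers of the block form are
  explicit. They also give the eigenvalue counts: all eigenvalues are \<open>0\<close> or \<open>p\<close>-th roots of
  unity, so \<open>trace (D ^ p)\<close> counts the peripheral ones and the mean of \<open>trace (D ^ m)\<close> over
  \<open>1 \<le> m \<le> p\<close> is the multiplicity of \<open>1\<close>.
\<close>

section \<open>Eigenvalue multiplicities from traces of powers\<close>

definition mat_trace :: "'a::comm_monoid_add mat \<Rightarrow> 'a" where
  "mat_trace A = (\<Sum>i<dim_row A. A $$ (i, i))"

lemma mult_mat_entry:
  assumes "A \<in> carrier_mat n n" "B \<in> carrier_mat n n" "i < n" "j < n"
  shows "(A * B) $$ (i, j) = (\<Sum>k<n. A $$ (i, k) * B $$ (k, j))"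
  using assms by (auto simp: scalar_prod_def lessThan_atLeast0 intro!: sum.cong)

lemma mat_trace_mult_comm:
  fixes A B :: "'a::comm_semiring_0 mat"
  assumes "A \<in> carrier_mat n n" "B \<in> carrier_mat n n"
  shows "mat_trace (A * B) = mat_trace (B * A)"
proof -
  have "mat_trace (A * B) = (\<Sum>i<n. \<Sum>k<n. A $$ (i, k) * B $$ (k, i))"
    using assms by (simp add: mat_trace_def mult_mat_entry del: index_mult_mat(1))
  also have "\<dots> = (\<Sum>k<n. \<Sum>i<n. B $$ (k, i) * A $$ (i, k))"
    by (subst sum.swap) (simp add: mult.commute)
  also have "\<dots> = mat_trace (B * A)"
    using assms by (simp add: mat_trace_def mult_mat_entry del: index_mult_mat(1))
  finally show ?thesis .
qed

lemma similar_mat_wit_trace: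
  fixes A B :: "'a::comm_ring_1 mat"
  assumes "similar_mat_wit A B P Q"
  shows "mat_trace A = mat_trace B"
proof -
  define n where "n = dim_row A"
  note w = similar_mat_witD[OF n_def assms]
  have "mat_trace A = mat_trace (P * (B * Q))"
    using w by (simp add: assoc_mult_mat[of P n n B n Q n])
  also have "\<dots> = mat_trace ((B * Q) * P)"
    using w by (intro mat_trace_mult_comm) auto
  also have "(B * Q) * P = B"
    using w by (simp add: assoc_mult_mat[of B n n Q n P n])
  finally show ?thesis .
qed

text \<open>The two claims need a joint induction: in a diagonal entry of the product, the terms on
  one side of the diagonal vanish because the power is triangular, those on the other side because
  \<open>A\<close> is.\<close>

lemma upper_triangular_pow:
  fixes A :: "'a::comm_ring_1 mat"
  assumes A: "A \<in> carrier_mat n n" and ut: "upper_triangular A"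
  shows "(\<forall>i<n. \<forall>j<i. (A ^\<^sub>m m) $$ (i, j) = 0) \<and> (\<forall>i<n. (A ^\<^sub>m m) $$ (i, i) = A $$ (i, i) ^ m)"
proof (induction m)
  case 0
  then show ?case using A by auto
next
  case (Suc m)
  have A0: "A $$ (i, j) = 0" if "i < n" "j < i" for i j
    using A ut that by (auto simp: upper_triangular_def)
  have P: "A ^\<^sub>m m \<in> carrier_mat n n"
    using A by simp
  have e: "(A ^\<^sub>m Suc m) $$ (i, j) = (\<Sum>k<n. (A ^\<^sub>m m) $$ (i, k) * A $$ (k, j))" if "i < n" "j < n" for i j
    using mult_mat_entry[OF P A that] by simp
  have "(A ^\<^sub>m Suc m) $$ (i, j) = 0" if "i < n" "j < i" for i j
  proof -
    have "(A ^\<^sub>m m) $$ (i, k) * A $$ (k, j) = 0" if "k < n" for k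
      using Suc A0[of k j] \<open>i < n\<close> \<open>j < i\<close> that by (cases "k < i") auto
    then show ?thesis using that by (simp add: e del: pow_mat.simps)
  qed
  moreover have "(A ^\<^sub>m Suc m) $$ (i, i) = A $$ (i, i) ^ Suc m" if "i < n" for i
  proof -
    have "(A ^\<^sub>m m) $$ (i, k) * A $$ (k, i) = (if k = i then A $$ (i, i) ^ Suc m else 0)" if "k < n" for k
      using Suc A0[of k i] \<open>i < n\<close> that by (cases k i rule: linorder_cases) auto
    then have "(A ^\<^sub>m Suc m) $$ (i, i) = (\<Sum>k<n. if k = i then A $$ (i, i) ^ Suc m else 0)"
      using that by (simp add: e del: pow_mat.simps power_Suc)
    then show ?thesis using that by simp
  qed
  ultimately show ?case by blast
qed

text \<open>A Schur decomposition makes \<open>A\<close> similar to a triangular matrix whose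
  diagonal is \<open>es\<close>, the roots of the characteristic polynomial repeated by
  multiplicity. Similarity preserves the traces of powers, and triangularity lets them be read off
  the diagonal.\<close>

lemma char_poly_roots_power_sums:
  fixes A :: "complex mat"
  assumes A: "A \<in> carrier_mat n n"
  obtains es where "char_poly A = (\<Prod>e\<leftarrow>es. [:- e, 1:])"
    and "\<And>m. mat_trace (A ^\<^sub>m m) = (\<Sum>e\<leftarrow>es. e ^ m)"
proof -
  obtain es where es: "char_poly A = (\<Prod>e\<leftarrow>es. [:- e, 1:])"
    using char_poly_factorized[OF A] by blast
  obtain B P Q where "schur_decomposition A es = (B, P, Q)"
    by (cases "schur_decomposition A es") auto
  from schur_decomposition[OF A es this]
  have wit: "similar_mat_wit A B P Q" and ut: "upper_triangular B" and diag: "diag_mat B = es"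
    by auto
  have B: "B \<in> carrier_mat n n"
    using similar_mat_witD2[OF A wit] by simp
  have "mat_trace (A ^\<^sub>m m) = (\<Sum>e\<leftarrow>es. e ^ m)" for m
  proof -
    have "mat_trace (A ^\<^sub>m m) = mat_trace (B ^\<^sub>m m)"
      by (rule similar_mat_wit_trace[OF similar_mat_wit_pow[OF wit]])
    also have "\<dots> = (\<Sum>i<n. B $$ (i, i) ^ m)"
      using upper_triangular_pow[OF B ut] B by (simp add: mat_trace_def)
    also have "\<dots> = (\<Sum>e\<leftarrow>es. e ^ m)"
      using B by (simp add: diag[symmetric] diag_mat_def o_def interv_sum_list_conv_sum_set_nat
        lessThan_atLeast0)
    finally show ?thesis .
  qed
  with es show thesis by (rule that)
qed

lemma order_linear_factors:
  fixes z :: "'a::field"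
  shows "Polynomial.order z (\<Prod>e\<leftarrow>es. [:- e, 1:]) = count_list es z"
proof (induction es)
  case Nil
  then show ?case by (simp add: order_0I)
next
  case (Cons e es)
  have 1: "(\<Prod>e\<leftarrow>es. [:- e, 1:]) \<noteq> 0"
    by (auto simp: prod_list_zero_iff)
  have 2: "Polynomial.order z [:- e, 1:] = (if e = z then 1 else 0)"
    using order_power_n_n[of z 1] by (auto simp: order_0I)
  show ?case using Cons 1 2 by (simp add: order_mult del: mult_pCons_left mult_pCons_right)
qed

text \<open>The hypothesis covers \<open>z = 0\<close> as well as the \<open>p\<close>-th roots of
  unity. Starting the geometric sum at \<open>m = 1\<close> makes it vanish for all of these except
  \<open>z = 1\<close>.\<close>

lemma sum_powers_root_of_unity:
  fixes z :: "'a::field"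
  assumes "z ^ (p + 1) = z" "0 < p"
  shows "(\<Sum>m=1..p. z ^ m) = (if z = 1 then of_nat p else 0)"
proof (cases "z = 1")
  case False
  have "(\<Sum>m=1..p. z ^ m) = z * (\<Sum>m<p. z ^ m)"
    using sum.atLeast1_atMost_eq[of "\<lambda>m. z ^ m" p] by (simp add: sum_distrib_left)
  also have "\<dots> = (z ^ (p + 1) - z) / (z - 1)"
    using False by (simp add: sum_gp_strict divide_simps algebra_simps)
  finally show ?thesis using assms False by simp
qed simp

text \<open>Passes from a sum over distinct eigenvalues, as in
  \<open>num_peripheral_eigenvalues\<close>, to a list with repetitions.\<close>

lemma sum_count_list_eq:
  "(\<Sum>z\<in>{z \<in> set es. P z}. count_list es z) = length (filter P es)"
proof -
  have "(\<Sum>z\<in>{z \<in> set es. P z}. count_list es z) = (\<Sum>z\<in>set (filter P es). count_list (filter P es) z)"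
    by (rule sum.cong) (auto simp: count_list_eq_length_filter filter_filter conj_commute
      intro!: arg_cong[of _ _ length] filter_cong)
  then show ?thesis by (simp add: sum_count_set)
qed

text \<open>Every root satisfies \<open>e ^ (p + 1) = e\<close>. Summing powers over a full period
  keeps only the roots equal to 1, each with weight \<open>p\<close>, while the \<open>p\<close>-th
  power alone is the indicator of modulus one. In the second claim the premise pins the spectral
  radius to 1.\<close>

lemma multiplicities_of_power_idempotent:
  fixes A :: "complex mat"
  assumes A: "A \<in> carrier_mat n n" and p: "0 < p" and cyc: "A ^\<^sub>m (p + 1) = A"
  shows "of_nat (p * alg_multiplicity A 1) = (\<Sum>m=1..p. mat_trace (A ^\<^sub>m m))"
    and "alg_multiplicity A 1 \<noteq> 0 \<Longrightarrow> of_nat (num_peripheral_eigenvalues A) = mat_trace (A ^\<^sub>m p)"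
proof -
  obtain es where cp: "char_poly A = (\<Prod>e\<leftarrow>es. [:- e, 1:])"
    and tr: "\<And>m. mat_trace (A ^\<^sub>m m) = (\<Sum>e\<leftarrow>es. e ^ m)"
    using char_poly_roots_power_sums[OF A] by blast
  have mult: "alg_multiplicity A z = count_list es z" for z
    by (simp add: alg_multiplicity_def cp order_linear_factors)
  have spec: "spectrum A = set es"
    unfolding spectrum_root_char_poly[OF A] cp
    by (auto simp: poly_prod_list prod_list_zero_iff)
  have root: "e ^ (p + 1) = e" if e: "e \<in> set es" for e
  proof -
    obtain v where v: "eigenvector A v e"
      using e unfolding spec[symmetric] spectrum_def eigenvalue_def by blast
    have "e ^ (p + 1) \<cdot>\<^sub>v v = e \<cdot>\<^sub>v v"
      using eigenvector_pow[OF A v, of "p + 1"] v cyc by (simp add: eigenvector_def)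
    moreover obtain i where "i < n" "v $ i \<noteq> 0"
      using v A by (auto simp: eigenvector_def vec_eq_iff)
    moreover have "dim_vec v = n"
      using v A by (auto simp: eigenvector_def)
    ultimately show ?thesis
      by (metis index_smult_vec(1) mult_right_cancel)
  qed
  have "(\<Sum>m=1..p. mat_trace (A ^\<^sub>m m)) = (\<Sum>e\<leftarrow>es. \<Sum>m=1..p. e ^ m)"
    unfolding tr by (induction es) (simp_all add: sum.distrib)
  also have "\<dots> = (\<Sum>e\<leftarrow>es. if e = 1 then of_nat p else 0)"
    using sum_powers_root_of_unity[OF root p] by (intro arg_cong[of _ _ sum_list] map_cong) simp_all
  also have "\<dots> = of_nat (p * count_list es 1)"
    by (induction es) (simp_all add: algebra_simps)
  finally show "of_nat (p * alg_multiplicity A 1) = (\<Sum>m=1..p. mat_trace (A ^\<^sub>m m))"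
    by (simp add: mult)
  \<comment> \<open>A root is 0 or a \<open>p\<close>-th root of unity, so \<open>e ^ p\<close>
    detects exactly the roots on the unit circle.\<close>
  have p1: "e ^ p = (if cmod e = 1 then 1 else 0)" "cmod e \<le> 1" if "e \<in> set es" for e
  proof -
    have e: "e = 0 \<or> e ^ p = 1" using root[OF that] by auto
    then have "e = 0 \<or> cmod e ^ p = 1" by (metis norm_one norm_power)
    then have "e = 0 \<or> cmod e = 1" using p by (metis norm_ge_zero power_eq_1_iff power_eq_imp_eq_base power_one gr_implies_not0)
    with e p show "e ^ p = (if cmod e = 1 then 1 else 0)" "cmod e \<le> 1" by auto
  qed
  assume "alg_multiplicity A 1 \<noteq> 0"
  then have one: "1 \<in> set es" by (simp add: mult count_list_0_iff)
  then have n: "n > 0"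
    using A spec eigenvalue_imp_nonzero_dim[OF A] by (auto simp: spectrum_def)
  have "spectral_radius A = 1"
  proof (rule antisym)
    show "spectral_radius A \<le> 1"
      using spectral_radius_mem_max(1)[OF A n] p1(2) spec by auto
    show "1 \<le> spectral_radius A"
      using spectral_radius_mem_max(2)[OF A n, of 1] one spec by (metis image_eqI norm_one)
  qed
  then have "num_peripheral_eigenvalues A = length (filter (\<lambda>z. cmod z = 1) es)"
    by (simp add: num_peripheral_eigenvalues_def spec mult sum_count_list_eq)
  also have "of_nat \<dots> = (\<Sum>e\<leftarrow>es. if cmod e = 1 then 1 else 0 :: complex)"
    by (induction es) simp_all
  also have "\<dots> = (\<Sum>e\<leftarrow>es. e ^ p)"
    using p1 by (intro arg_cong[of _ _ sum_list] map_cong) simp_all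
  finally show "of_nat (num_peripheral_eigenvalues A) = mat_trace (A ^\<^sub>m p)"
    by (simp add: tr)
qed

section \<open>Powers in cyclic block coordinates\<close>

text \<open>
  The triple \<open>(j, a, b)\<close> stands for the row \<open>a * k j + b\<close> of the \<open>j\<close>-th block \<open>K \<otimes> J\<close>, and
  \<open>cyc_entry h k m\<close> gives the entries of the \<open>m\<close>-th power (for \<open>m > 0\<close>) of the block matrix.
\<close>

definition cyc_index :: "nat \<Rightarrow> (nat \<Rightarrow> nat) \<Rightarrow> (nat \<Rightarrow> nat) \<Rightarrow> (nat \<times> nat \<times> nat) set" where
  "cyc_index r h k = (SIGMA j:{1..r}. {..<h j} \<times> {..<k j})"

fun cyc_entry ::
    "(nat \<Rightarrow> nat) \<Rightarrow> (nat \<Rightarrow> nat) \<Rightarrow> nat \<Rightarrow> nat \<times> nat \<times> nat \<Rightarrow> nat \<times> nat \<times> nat \<Rightarrow> real" where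
  "cyc_entry h k m (j, a, b) (j', a', b') = (if j = j' \<and> a' = (a + m) mod h j then 1 / real (k j) else 0)"

text \<open>A relabelling of rows and columns by block coordinates takes the place of conjugation by
  a permutation matrix: sums over rows turn into sums over triples, without any offset
  arithmetic.\<close>

definition cyc_coords ::
    "real mat \<Rightarrow> nat \<Rightarrow> nat \<Rightarrow> (nat \<Rightarrow> nat) \<Rightarrow> (nat \<Rightarrow> nat) \<Rightarrow> (nat \<times> nat \<times> nat \<Rightarrow> nat) \<Rightarrow> bool" where
  "cyc_coords D n r h k \<psi> \<longleftrightarrow> bij_betw \<psi> (cyc_index r h k) {..<n} \<and>
     (\<forall>s\<in>cyc_index r h k. \<forall>t\<in>cyc_index r h k. D $$ (\<psi> s, \<psi> t) = cyc_entry h k 1 s t)"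

lemma sum_cyc_index:
  "(\<Sum>s\<in>cyc_index r h k. f s) = (\<Sum>j=1..r. \<Sum>a<h j. \<Sum>b<k j. f (j, a, b))"
  by (simp add: cyc_index_def sum.Sigma sum.cartesian_product)

text \<open>Cyclic shifts add up and averaging over a class is idempotent: from \<open>s\<close>
  only the class at position \<open>(a + m) mod h j\<close> is reached.\<close>

lemma cyc_entry_comp:
  assumes h: "\<forall>j\<in>{1..r}. 0 < h j \<and> 0 < k j" and s: "s \<in> cyc_index r h k"
  shows "(\<Sum>t\<in>cyc_index r h k. cyc_entry h k m s t * cyc_entry h k l t u) = cyc_entry h k (m + l) s u"
proof -
  obtain j a b j' a' b' where s': "s = (j, a, b)" "u = (j', a', b')"
    by (metis prod_cases3)
  have j: "j \<in> {1..r}" "a < h j" "b < k j" using s s' by (auto simp: cyc_index_def)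
  let ?c = "if j = j' \<and> a' = (a + m + l) mod h j then 1 / real (k j) else 0"
  have "(\<Sum>c<h i. \<Sum>d<k i. cyc_entry h k m s (i, c, d) * cyc_entry h k l (i, c, d) u) =
      (if i = j then ?c else 0)" for i
  proof (cases "i = j")
    case True
    \<comment> \<open>The \<open>k j\<close> intermediate points contribute
      \<open>1 / (k j)^2\<close> each, which gives \<open>1 / k j\<close> again.\<close>
    have "(\<Sum>d<k j. cyc_entry h k m s (j, c, d) * cyc_entry h k l (j, c, d) u) =
        (if c = (a + m) mod h j then ?c else 0)" for c
      using j h by (auto simp: s' mod_add_left_eq)
    then show ?thesis using True j h by (simp add: sum.delta)
  qed (simp add: s')
  then have "(\<Sum>t\<in>cyc_index r h k. cyc_entry h k m s t * cyc_entry h k l t u) = ?c"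
    using j by (simp add: sum_cyc_index)
  then show ?thesis by (simp add: s' add.assoc)
qed

text \<open>Restricted to positive powers because the zeroth power is the identity, whereas
  \<open>cyc_entry h k 0\<close> is the averaging projection onto the classes.\<close>

lemma cyc_coords_pow:
  assumes D: "D \<in> carrier_mat n n" and c: "cyc_coords D n r h k \<psi>"
    and h: "\<forall>j\<in>{1..r}. 0 < h j \<and> 0 < k j"
    and st: "s \<in> cyc_index r h k" "t \<in> cyc_index r h k"
  shows "(D ^\<^sub>m Suc m) $$ (\<psi> s, \<psi> t) = cyc_entry h k (Suc m) s t"
  using st
proof (induction m arbitrary: t)
  case 0
  have "1\<^sub>m (dim_row D) * D = D" using D by simp
  then show ?case using 0 c by (simp add: cyc_coords_def)
next
  case (Suc m)
  have bij: "bij_betw \<psi> (cyc_index r h k) {..<n}" using c by (simp add: cyc_coords_def)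
  have lt: "\<psi> s < n" if "s \<in> cyc_index r h k" for s
    using bij_betwE[OF bij] that by auto
  have P: "D ^\<^sub>m Suc m \<in> carrier_mat n n" using D by (rule pow_carrier_mat)
  have "(D ^\<^sub>m Suc (Suc m)) $$ (\<psi> s, \<psi> t) = (\<Sum>x<n. (D ^\<^sub>m Suc m) $$ (\<psi> s, x) * D $$ (x, \<psi> t))"
    using mult_mat_entry[OF P D lt lt] Suc.prems by simp
  also have "\<dots> = (\<Sum>u\<in>cyc_index r h k. (D ^\<^sub>m Suc m) $$ (\<psi> s, \<psi> u) * D $$ (\<psi> u, \<psi> t))"
    by (rule sum.reindex_bij_betw[OF bij, symmetric])
  also have "\<dots> = (\<Sum>u\<in>cyc_index r h k. cyc_entry h k (Suc m) s u * cyc_entry h k 1 u t)"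
    using Suc c by (intro sum.cong refl arg_cong2[of _ _ _ _ "(*)"]) (auto simp: cyc_coords_def)
  also have "\<dots> = cyc_entry h k (Suc (Suc m)) s t"
    using cyc_entry_comp[OF h Suc.prems(1), of "Suc m" 1 t] by simp
  finally show ?case .
qed

text \<open>A shift by \<open>m\<close> on a cycle of length \<open>h j\<close> fixes every position
  or none, according to whether \<open>h j\<close> divides \<open>m\<close>. Each fixed position
  carries \<open>k j\<close> diagonal entries \<open>1 / k j\<close>, hence contributes 1.\<close>

lemma cyc_coords_trace:
  assumes D: "D \<in> carrier_mat n n" and c: "cyc_coords D n r h k \<psi>"
    and h: "\<forall>j\<in>{1..r}. 0 < h j \<and> 0 < k j" and m: "0 < m"
  shows "mat_trace (D ^\<^sub>m m) = (\<Sum>j=1..r. if h j dvd m then real (h j) else 0)"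
proof -
  obtain l where l: "m = Suc l" using m gr0_implies_Suc by blast
  have bij: "bij_betw \<psi> (cyc_index r h k) {..<n}" using c by (simp add: cyc_coords_def)
  have 1: "a = (a + m) mod h \<longleftrightarrow> h dvd m" if "a < h" for a h
  proof -
    have "a = (a + m) mod h \<longleftrightarrow> [a + 0 = a + m] (mod h)" using that by (simp add: cong_def)
    then show ?thesis by (metis cong_0_iff cong_add_lcancel_nat cong_sym_eq)
  qed
  have "mat_trace (D ^\<^sub>m m) = (\<Sum>s\<in>cyc_index r h k. (D ^\<^sub>m m) $$ (\<psi> s, \<psi> s))"
    using D sum.reindex_bij_betw[OF bij, of "\<lambda>x. (D ^\<^sub>m m) $$ (x, x)"] by (simp add: mat_trace_def)
  also have "\<dots> = (\<Sum>s\<in>cyc_index r h k. cyc_entry h k m s s)"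
    using cyc_coords_pow[OF D c h] by (intro sum.cong) (simp_all add: l del: pow_mat.simps)
  also have "\<dots> = (\<Sum>j=1..r. if h j dvd m then real (h j) else 0)"
    unfolding sum_cyc_index
  proof (rule sum.cong[OF refl])
    fix j assume "j \<in> {1..r}"
    then have "k j \<noteq> 0" using h by auto
    then show "(\<Sum>a<h j. \<Sum>b<k j. cyc_entry h k m (j, a, b) (j, a, b)) = (if h j dvd m then real (h j) else 0)"
      by (simp add: 1)
  qed
  finally show ?thesis .
qed

text \<open>Shifts by \<open>m + 1\<close> and by 1 agree on a cycle exactly when its length divides
  \<open>m\<close>, and this has to hold on all cycles at once.\<close>

lemma cyc_coords_pow_eq_iff:
  assumes D: "D \<in> carrier_mat n n" and c: "cyc_coords D n r h k \<psi>"
    and h: "\<forall>j\<in>{1..r}. 0 < h j \<and> 0 < k j"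
  shows "D ^\<^sub>m (m + 1) = D \<longleftrightarrow> Lcm (h ` {1..r}) dvd m"
proof -
  let ?I = "cyc_index r h k"
  have bij: "bij_betw \<psi> ?I {..<n}" using c by (simp add: cyc_coords_def)
  have "D ^\<^sub>m (m + 1) = D \<longleftrightarrow> (\<forall>x\<in>{..<n}. \<forall>y\<in>{..<n}. (D ^\<^sub>m Suc m) $$ (x, y) = D $$ (x, y))"
    using D by (auto simp: mat_eq_iff simp del: pow_mat.simps)
  also have "\<dots> \<longleftrightarrow> (\<forall>s\<in>?I. \<forall>t\<in>?I. cyc_entry h k (Suc m) s t = cyc_entry h k 1 s t)"
    unfolding bij_betw_imp_surj_on[OF bij, symmetric] ball_simps
    using c cyc_coords_pow[OF D c h] by (auto simp: cyc_coords_def simp del: pow_mat.simps)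
  also have "\<dots> \<longleftrightarrow> (\<forall>j\<in>{1..r}. h j dvd m)"
  proof (intro iffI ballI)
    fix j assume *: "\<forall>s\<in>?I. \<forall>t\<in>?I. cyc_entry h k (Suc m) s t = cyc_entry h k 1 s t" and j: "j \<in> {1..r}"
    have hk: "0 < h j" "0 < k j" using h j by auto
    \<comment> \<open>One nonzero entry of \<open>D\<close> per cycle suffices as a test. The
      reduction \<open>1 mod h j\<close> covers cycles of length 1, where position 0 follows
      itself.\<close>
    then have "(j, 0, 0) \<in> ?I" "(j, 1 mod h j, 0) \<in> ?I" using j by (simp_all add: cyc_index_def)
    with * have "cyc_entry h k (Suc m) (j, 0, 0) (j, 1 mod h j, 0) = cyc_entry h k 1 (j, 0, 0) (j, 1 mod h j, 0)"
      by blast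
    then have "[1 + 0 = 1 + m] (mod h j)" using hk by (auto simp: cong_def split: if_splits)
    then show "h j dvd m" by (metis cong_0_iff cong_add_lcancel_nat cong_sym_eq)
  next
    fix s t assume d: "\<forall>j\<in>{1..r}. h j dvd m" and st: "s \<in> ?I" "t \<in> ?I"
    obtain j a b j' a' b' where s': "s = (j, a, b)" "t = (j', a', b')"
      by (metis prod_cases3)
    have "j \<in> {1..r}" using st s' by (auto simp: cyc_index_def)
    with d obtain q where "m = h j * q" by (blast elim: dvdE)
    then have "(a + Suc m) mod h j = (a + 1) mod h j"
      by (metis Suc_eq_plus1 add.assoc add.commute mod_mult_self2)
    then show "cyc_entry h k (Suc m) s t = cyc_entry h k 1 s t" by (simp add: s')
  qed
  also have "\<dots> \<longleftrightarrow> Lcm (h ` {1..r}) dvd m" by (auto simp: Lcm_dvd_iff)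
  finally show ?thesis .
qed

section \<open>From permutations to cyclic coordinates\<close>

text \<open>The orbits of \<open>T\<close> partition \<open>Q\<close>. After numbering them and
  choosing a base point \<open>x j\<close> in each, a point is determined by its orbit and by the
  number \<open>a\<close> of steps from the base point.\<close>

lemma permutes_cycle_coordinates:
  assumes T: "T permutes Q" and Q: "finite Q" "Q \<noteq> {}"
  obtains r h g where "0 < r" "\<forall>j\<in>{1..r}. 0 < h j"
    and "bij_betw g (SIGMA j:{1..r::nat}. {..<h j}) Q"
    and "\<forall>j\<in>{1..r}. \<forall>a<h j. T (g (j, a)) = g (j, Suc a mod h j)"
proof -
  define Os where "Os = orbit T ` Q"
  have finO: "finite Os" and O0: "Os \<noteq> {}"
    using Q by (auto simp: Os_def)
  have perm: "permutation T"
    using T Q by (auto simp: permutation_permutes)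
  have self: "x \<in> orbit T x" for x
    by (rule permutation_self_in_orbit[OF perm])
  define r where "r = card Os"
  have r0: "0 < r" using finO O0 by (simp add: r_def card_gt_0_iff)
  obtain q where q: "bij_betw q {1..r} Os"
    using finite_same_card_bij[OF _ finO, of "{1..r}"] by (auto simp: r_def)
  define x where "x j = (SOME x. x \<in> Q \<and> orbit T x = q j)" for j
  have x: "x j \<in> Q \<and> orbit T (x j) = q j" if "j \<in> {1..r}" for j
    unfolding x_def
    by (rule someI_ex) (use bij_betwE[OF q] that in \<open>fastforce simp: Os_def\<close>)
  \<comment> \<open>The first positive return time of the base point, which is the length of its
    orbit.\<close>
  define h where "h j = funpow_dist1 T (x j) (x j)" for j
  define g where "g = (\<lambda>(j, a). (T ^^ a) (x j))"
  have h0: "0 < h j" for j by (simp add: h_def)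
  have hx: "(T ^^ h j) (x j) = x j" for j
    unfolding h_def by (rule funpow_dist1_prop[OF self])
  have img: "(\<lambda>a. (T ^^ a) (x j)) ` {..<h j} = orbit T (x j)" for j
    using orbit_conv_funpow_dist1[OF self[of "x j"]] by (simp add: h_def lessThan_atLeast0)
  have inj: "inj_on (\<lambda>a. (T ^^ a) (x j)) {..<h j}" for j
    using inj_on_funpow_dist1[OF self[of "x j"]] by (simp add: h_def lessThan_atLeast0)
  have inj_g: "inj_on g (SIGMA j:{1..r}. {..<h j})"
  proof (rule inj_onI, clarify)
    fix j a j' a'
    assume j: "j \<in> {1..r}" "j' \<in> {1..r}" and a: "a < h j" "a' < h j'" and eq: "g (j, a) = g (j', a')"
    have "g (j, a) \<in> orbit T (x j)" "g (j', a') \<in> orbit T (x j')"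
      using img[of j] img[of j'] a by (auto simp: g_def)
    then have "g (j, a) \<in> orbit T (x j)" "g (j, a) \<in> orbit T (x j')"
      by (simp_all add: eq)
    then have "orbit T (x j) = orbit T (x j')"
      using cyclic_on_orbit'[OF perm] orbit_cyclic_eq3 by metis
    then have "q j = q j'" using x j by metis
    then have "j = j'" using inj_onD[OF bij_betw_imp_inj_on[OF q]] j by blast
    moreover from this have "a = a'" using inj_onD[OF inj[of j], of a a'] eq a by (simp add: g_def)
    ultimately show "j = j' \<and> a = a'" by blast
  qed
  have "g ` (SIGMA j:{1..r}. {..<h j}) = (\<Union>j\<in>{1..r}. (\<lambda>a. g (j, a)) ` {..<h j})"
    by force
  also have "\<dots> = (\<Union>j\<in>{1..r}. orbit T (x j))"
    by (simp add: g_def img)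
  also have "\<dots> = \<Union> (q ` {1..r})" using x by auto
  also have "\<dots> = \<Union> Os" using q by (simp add: bij_betw_def)
  also have "\<dots> = Q"
    using self permutes_orbit_subset[OF T] by (auto simp: Os_def)
  finally have "bij_betw g (SIGMA j:{1..r}. {..<h j}) Q"
    using inj_g by (simp add: bij_betw_def)
  moreover have "T (g (j, a)) = g (j, Suc a mod h j)" if "a < h j" for j a
  proof -
    have "T (g (j, a)) = (T ^^ Suc a) (x j)" by (simp add: g_def)
    then show ?thesis
      using that hx[of j] h0[of j] by (cases "Suc a = h j") (simp_all add: g_def)
  qed
  ultimately show thesis using r0 h0 by (intro that) auto
qed

section \<open>Bistochastic kernels on a finite set and their cyclic classes\<close>

definition bistochastic_on :: "'a set \<Rightarrow> ('a \<Rightarrow> 'a \<Rightarrow> real) \<Rightarrow> bool" where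
  "bistochastic_on S d \<longleftrightarrow> (\<forall>i\<in>S. \<forall>j\<in>S. 0 \<le> d i j) \<and>
     (\<forall>i\<in>S. (\<Sum>j\<in>S. d i j) = 1) \<and> (\<forall>j\<in>S. (\<Sum>i\<in>S. d i j) = 1)"

lemma bistochastic_on_transpose:
  "bistochastic_on S d \<Longrightarrow> bistochastic_on S (\<lambda>i j. d j i)"
  by (auto simp: bistochastic_on_def)

lemma idempotent_bistochastic_rows_eq:
  assumes e: "bistochastic_on S e" and "finite S"
    and idem: "\<And>i j. i \<in> S \<Longrightarrow> j \<in> S \<Longrightarrow> (\<Sum>k\<in>S. e i k * e k j) = e i j"
    and ij: "i \<in> S" "j \<in> S" "0 < e i j" and l: "l \<in> S"
  shows "e i l = e j l"
proof -
  txt \<open>The column \<open>?x\<close> satisfies \<open>E ?x = ?x\<close>, which makes its Dirichlet form for \<open>E\<close> vanish.\<close>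
  let ?x = "\<lambda>i. e i l"
  have nn: "0 \<le> e a b * (?x a - ?x b)\<^sup>2" if "a \<in> S" "b \<in> S" for a b
    using e that by (simp add: bistochastic_on_def)
  have "(\<Sum>a\<in>S. \<Sum>b\<in>S. e a b * (?x a - ?x b)\<^sup>2) =
      (\<Sum>a\<in>S. \<Sum>b\<in>S. e a b * (?x a)\<^sup>2) + (\<Sum>a\<in>S. \<Sum>b\<in>S. e a b * (?x b)\<^sup>2)
      - (\<Sum>a\<in>S. \<Sum>b\<in>S. 2 * ?x a * (e a b * ?x b))"
    by (simp add: power2_diff algebra_simps sum.distrib sum_subtractf)
  \<comment> \<open>Row sums simplify the first term, column sums the second, and
    \<open>E ?x = ?x\<close> the mixed one; the total is one sum of squares plus the same again
    minus twice that sum.\<close>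
  also have "(\<Sum>a\<in>S. \<Sum>b\<in>S. e a b * (?x a)\<^sup>2) = (\<Sum>a\<in>S. (?x a)\<^sup>2)"
    using e by (simp add: bistochastic_on_def flip: sum_distrib_right)
  also have "(\<Sum>a\<in>S. \<Sum>b\<in>S. e a b * (?x b)\<^sup>2) = (\<Sum>b\<in>S. (?x b)\<^sup>2)"
    using e by (subst sum.swap) (simp add: bistochastic_on_def flip: sum_distrib_right)
  also have "(\<Sum>a\<in>S. \<Sum>b\<in>S. 2 * ?x a * (e a b * ?x b)) = (\<Sum>a\<in>S. 2 * (?x a)\<^sup>2)"
    using idem l by (simp add: power2_eq_square mult.assoc flip: sum_distrib_left)
  finally have "(\<Sum>a\<in>S. \<Sum>b\<in>S. e a b * (?x a - ?x b)\<^sup>2) = 0"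
    by (simp flip: sum_distrib_left)
  then have "\<forall>a\<in>S. \<forall>b\<in>S. e a b * (?x a - ?x b)\<^sup>2 = 0"
    using nn \<open>finite S\<close> by (simp add: sum_nonneg_eq_0_iff sum_nonneg del: mult_eq_0_iff)
  then have "e i j * (?x i - ?x j)\<^sup>2 = 0" using ij by blast
  then show ?thesis using ij by simp
qed

lemma sum_nonneg_pos_iff:
  fixes f :: "'a \<Rightarrow> real"
  assumes "finite S" "\<And>i. i \<in> S \<Longrightarrow> 0 \<le> f i"
  shows "0 < (\<Sum>i\<in>S. f i) \<longleftrightarrow> (\<exists>i\<in>S. 0 < f i)"
  using assms sum_nonneg[of S f] sum_nonneg_eq_0_iff[of S f] by (smt (verit))

text \<open>Here \<open>e\<close> is the idempotent, \<open>d\<close> the given kernel and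
  \<open>d'\<close> an inverse of \<open>d\<close> relative to \<open>e\<close>. Absorbing
  \<open>e\<close> on both sides makes \<open>d\<close> constant on pairs of classes of
  \<open>e\<close>; the inverse prevents \<open>d\<close> from splitting or merging classes. So
  \<open>d\<close> induces a permutation \<open>T\<close> of the classes, whose cycles supply the
  coordinates.\<close>

lemma bistochastic_cycle_structure:
  fixes d d' e :: "'a \<Rightarrow> 'a \<Rightarrow> real"
  assumes fin: "finite S" and ne: "S \<noteq> {}"
    and d: "bistochastic_on S d" and d': "bistochastic_on S d'" and e: "bistochastic_on S e"
    and ee: "\<And>i j. i \<in> S \<Longrightarrow> j \<in> S \<Longrightarrow> (\<Sum>k\<in>S. e i k * e k j) = e i j"
    and ed: "\<And>i j. i \<in> S \<Longrightarrow> j \<in> S \<Longrightarrow> (\<Sum>k\<in>S. e i k * d k j) = d i j"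
    and de: "\<And>i j. i \<in> S \<Longrightarrow> j \<in> S \<Longrightarrow> (\<Sum>k\<in>S. d i k * e k j) = d i j"
    and dd': "\<And>i j. i \<in> S \<Longrightarrow> j \<in> S \<Longrightarrow> (\<Sum>k\<in>S. d i k * d' k j) = e i j"
    and d'd: "\<And>i j. i \<in> S \<Longrightarrow> j \<in> S \<Longrightarrow> (\<Sum>k\<in>S. d' i k * d k j) = e i j"
  obtains r h k \<psi> where "0 < r" "\<forall>j\<in>{1..r}. 0 < h j \<and> 0 < k j"
    and "bij_betw \<psi> (cyc_index r h k) S"
    and "\<forall>s\<in>cyc_index r h k. \<forall>t\<in>cyc_index r h k. d (\<psi> s) (\<psi> t) = cyc_entry h k 1 s t"
proof -
  note bi = d d' e
  have nn: "0 \<le> d i j" "0 \<le> d' i j" "0 \<le> e i j" if "i \<in> S" "j \<in> S" for i j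
    using bi that by (auto simp: bistochastic_on_def)
  have ex: "\<exists>j\<in>S. 0 < f i j" "\<exists>j\<in>S. 0 < f j i" if "bistochastic_on S f" "i \<in> S" for f :: "'a \<Rightarrow> 'a \<Rightarrow> real" and i
    using that sum_nonneg_pos_iff[OF fin, of "\<lambda>j. f i j"] sum_nonneg_pos_iff[OF fin, of "\<lambda>j. f j i"]
    by (auto simp: bistochastic_on_def)
  have row: "e i l = e j l" if "0 < e i j" "i \<in> S" "j \<in> S" "l \<in> S" for i j l
    using idempotent_bistochastic_rows_eq[OF e fin ee] that by blast
  have col: "e l i = e l j" if "0 < e j i" "i \<in> S" "j \<in> S" "l \<in> S" for i j l
    using idempotent_bistochastic_rows_eq[OF bistochastic_on_transpose[OF e] fin, of i j l] ee that
    by (simp add: mult.commute)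
  \<comment> \<open>A unit column sum provides some \<open>j\<close> with \<open>0 < e j i\<close>,
    and equality of the rows of \<open>j\<close> and \<open>i\<close> carries this value to the
    diagonal.\<close>
  have refl: "0 < e i i" if i: "i \<in> S" for i
  proof -
    obtain j where "j \<in> S" "0 < e j i" using ex(2)[OF e i] by blast
    then show ?thesis using row[of j i i] i by simp
  qed
  have sym: "0 < e j i" if "0 < e i j" "i \<in> S" "j \<in> S" for i j
    using row[of i j i] refl[of i] that by simp
  have trans: "0 < e i l" if "0 < e i j" "0 < e j l" "i \<in> S" "j \<in> S" "l \<in> S" for i j l
    using row[of i j l] that by simp
  have drow: "d i l = d j l" if "0 < e i j" "i \<in> S" "j \<in> S" "l \<in> S" for i j l
    using ed[of i l] ed[of j l] row[of i j] that by (metis (no_types, lifting) sum.cong)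
  have dcol: "d l i = d l j" if "0 < e i j" "i \<in> S" "j \<in> S" "l \<in> S" for i j l
    using de[of l i] de[of l j] col[of i j] sym[of i j] that by (metis (no_types, lifting) sum.cong)
  \<comment> \<open>All successors of \<open>i\<close> under \<open>d\<close> lie in one class: a
    step of \<open>d'\<close> from some \<open>l\<close> to \<open>i\<close>, followed by a step of
    \<open>d\<close>, is a positive path of \<open>e\<close>, so every successor is equivalent to
    \<open>l\<close>.\<close>
  have out: "0 < e j j'" if "0 < d i j" "0 < d i j'" "i \<in> S" "j \<in> S" "j' \<in> S" for i j j'
  proof -
    obtain l where l: "l \<in> S" "0 < d' l i" using ex(2)[OF d' \<open>i \<in> S\<close>] by blast
    have "0 < e l x" if "0 < d i x" "x \<in> S" for x
    proof -
      have "0 < (\<Sum>k\<in>S. d' l k * d k x)"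
        using fin \<open>i \<in> S\<close> by (rule sum_pos2) (use nn that l in auto)
      then show ?thesis using d'd that l by simp
    qed
    then show ?thesis using that trans[of j l j'] sym[of l j] l by blast
  qed
  \<comment> \<open>The dual argument for predecessors, with \<open>d\<close> followed by
    \<open>d'\<close>.\<close>
  have inn: "0 < e i i'" if "0 < d i j" "0 < d i' j" "i \<in> S" "i' \<in> S" "j \<in> S" for i i' j
  proof -
    obtain l where l: "l \<in> S" "0 < d' j l" using ex(1)[OF d' \<open>j \<in> S\<close>] by blast
    have "0 < e x l" if "0 < d x j" "x \<in> S" for x
    proof -
      have "0 < (\<Sum>k\<in>S. d x k * d' k l)"
        using fin \<open>j \<in> S\<close> by (rule sum_pos2) (use nn that l in auto)
      then show ?thesis using dd' that l by simp
    qed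
    then show ?thesis using that trans[of i l i'] sym[of i' l] l by blast
  qed
  define cl where "cl i = {j\<in>S. 0 < e i j}" for i
  define ou where "ou i = {j\<in>S. 0 < d i j}" for i
  have fincl: "finite (cl i)" for i using fin by (simp add: cl_def)
  have cl_eq: "cl i = cl j \<longleftrightarrow> 0 < e i j" if "i \<in> S" "j \<in> S" for i j
    using that refl sym trans unfolding cl_def by blast
  have mem_cl: "i \<in> cl i" if "i \<in> S" for i using that refl by (simp add: cl_def)
  \<comment> \<open>The successors lie within one class by \<open>out\<close> and exhaust it by
    \<open>dcol\<close>.\<close>
  have ou_cl: "ou i = cl j" if "0 < d i j" "i \<in> S" "j \<in> S" for i j
    using that out dcol unfolding cl_def ou_def by (smt (verit) Collect_cong)
  have ou_cong: "ou i = ou j" if "cl i = cl j" "i \<in> S" "j \<in> S" for i j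
    using that cl_eq drow unfolding ou_def by (smt (verit) Collect_cong)
  have ou_inj: "cl i = cl j" if "ou i = ou j" "i \<in> S" "j \<in> S" for i j
    using that ex(1)[OF d \<open>i \<in> S\<close>] inn cl_eq unfolding ou_def by blast
  \<comment> \<open>Row \<open>i\<close> consists of \<open>card (cl j)\<close> copies of
    \<open>d i j\<close> and zeros, column \<open>j\<close> of \<open>card (cl i)\<close> copies and
    zeros. Both sum to 1, so the two classes have equal size.\<close>
  have val: "d i j = 1 / card (cl i) \<and> card (cl i) = card (cl j)" if "0 < d i j" "i \<in> S" "j \<in> S" for i j
  proof -
    have "1 = (\<Sum>x\<in>S. d i x)" using d that by (simp add: bistochastic_on_def)
    also have "\<dots> = (\<Sum>x\<in>ou i. d i x)"
      using fin nn that unfolding ou_def by (intro sum.mono_neutral_right) (auto simp: less_le)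
    also have "\<dots> = (\<Sum>x\<in>ou i. d i j)"
      using that ou_cl dcol by (intro sum.cong) (auto simp: cl_def)
    finally have 1: "1 = card (cl j) * d i j" using ou_cl that by simp
    have "1 = (\<Sum>x\<in>S. d x j)" using d that by (simp add: bistochastic_on_def)
    also have "\<dots> = (\<Sum>x\<in>cl i. d x j)"
      using fin nn that inn unfolding cl_def by (intro sum.mono_neutral_right) (auto simp: less_le)
    also have "\<dots> = (\<Sum>x\<in>cl i. d i j)"
      using that drow by (intro sum.cong) (auto simp: cl_def)
    finally have 2: "1 = card (cl i) * d i j" by simp
    have "real (card (cl i)) * d i j = real (card (cl j)) * d i j" using 1 2 by simp
    then have "card (cl i) = card (cl j)" using that(1) by simp
    moreover have "d i j = 1 / card (cl i)" using 2 by (auto simp: eq_divide_eq mult.commute)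
    ultimately show ?thesis by simp
  qed
  define Q where "Q = cl ` S"
  \<comment> \<open>By \<open>ou_cong\<close> the choice of representative is immaterial. Outside
    \<open>Q\<close> the map is the identity, as \<open>permutes\<close> requires.\<close>
  define T where "T C = (if C \<in> Q then ou (SOME i. i \<in> S \<and> cl i = C) else C)" for C
  have T: "T (cl i) = ou i" if "i \<in> S" for i
  proof -
    define c where "c = (SOME x. x \<in> S \<and> cl x = cl i)"
    have c: "c \<in> S \<and> cl c = cl i"
      unfolding c_def by (rule someI[of _ i]) (use that in simp)
    have "T (cl i) = ou c" using that by (simp add: T_def Q_def c_def)
    also have "\<dots> = ou i" using c that by (intro ou_cong) auto
    finally show ?thesis .
  qed
  have finQ: "finite Q" and neQ: "Q \<noteq> {}" using fin ne by (auto simp: Q_def)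
  have ou_Q: "ou i \<in> Q" if "i \<in> S" for i
  proof -
    obtain j where "j \<in> S" "0 < d i j" using ex(1)[OF d \<open>i \<in> S\<close>] by blast
    then have "ou i = cl j" "j \<in> S" using ou_cl that by auto
    then show ?thesis by (simp add: Q_def)
  qed
  have "inj_on T Q"
    unfolding Q_def by (rule inj_onI) (use T ou_inj in \<open>metis imageE\<close>)
  moreover have "T ` Q \<subseteq> Q"
    using T ou_Q unfolding Q_def by force
  ultimately have "bij_betw T Q Q" using finQ by (simp add: bij_betw_def endo_inj_surj)
  then have "T permutes Q" by (rule bij_imp_permutes) (simp add: T_def)
  then obtain r :: nat and h g where r: "0 < r" and h: "\<forall>j\<in>{1..r}. 0 < h j"
    and g: "bij_betw g (SIGMA j:{1..r}. {..<h j}) Q"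
    and Tg: "\<forall>j\<in>{1..r}. \<forall>a<h j. T (g (j, a)) = g (j, Suc a mod h j)"
    using permutes_cycle_coordinates[OF _ finQ neQ] by blast
  \<comment> \<open>The class at position 0 sets the size for its whole cycle, since
    \<open>T\<close> preserves cardinalities.\<close>
  define k where "k j = card (g (j, 0))" for j :: nat
  have gQ: "g (j, a) \<in> Q" if "j \<in> {1..r}" "a < h j" for j a
    using bij_betwE[OF g] that by auto
  have Tg: "T (g (j, a)) = g (j, Suc a mod h j)" if "j \<in> {1..r}" "a < h j" for j a
    using Tg that by blast
  have card_T: "card (T C) = card C" if "C \<in> Q" for C
  proof -
    obtain i where i: "i \<in> S" "C = cl i" using \<open>C \<in> Q\<close> by (auto simp: Q_def)
    obtain j where "j \<in> S" "0 < d i j" using ex(1)[OF d \<open>i \<in> S\<close>] by blast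
    then have "ou i = cl j" "card (cl i) = card (cl j)" using ou_cl val i by auto
    then show ?thesis using T i by simp
  qed
  have card_g: "card (g (j, a)) = k j" if "j \<in> {1..r}" "a < h j" for j a
    using that(2)
  proof (induction a)
    case (Suc a)
    have "g (j, Suc a) = T (g (j, a))" using Tg[OF that(1), of a] Suc.prems by simp
    then show ?case using card_T[OF gQ[OF that(1), of a]] Suc by simp
  qed (simp add: k_def)
  have k0: "0 < k j" if "j \<in> {1..r}" for j
  proof -
    have "0 < h j" using h that by blast
    then obtain i where "i \<in> S" "g (j, 0) = cl i" using gQ[OF \<open>j \<in> {1..r}\<close>] by (auto simp: Q_def)
    then show ?thesis using mem_cl[of i] fincl[of i] by (auto simp: k_def card_gt_0_iff)
  qed
  \<comment> \<open>Any enumeration of a class will do, because \<open>d\<close> does not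
    distinguish points of the same class.\<close>
  define en where "en C = (SOME f. bij_betw f {..<card C} C)" for C :: "'a set"
  have en: "bij_betw (en C) {..<card C} C" if "C \<in> Q" for C
    unfolding en_def using that fincl ex_bij_betw_nat_finite[of C]
    by (intro someI_ex[of "\<lambda>f. bij_betw f {..<card C} C"]) (auto simp: Q_def lessThan_atLeast0)
  define \<psi> where "\<psi> = (\<lambda>(j, a, b). en (g (j, a)) b)"
  have en_mem: "\<psi> (j, a, b) \<in> g (j, a)" if "j \<in> {1..r}" "a < h j" "b < k j" for j a b
    using bij_betwE[OF en[OF gQ[OF that(1,2)]]] that(3) card_g[OF that(1,2)] by (simp add: \<psi>_def)
  have memQ: "x \<in> S \<and> cl x = C" if "C \<in> Q" "x \<in> C" for x C
  proof -
    obtain i where i: "i \<in> S" "C = cl i" using \<open>C \<in> Q\<close> by (auto simp: Q_def)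
    then have "x \<in> S" "0 < e i x" using \<open>x \<in> C\<close> by (auto simp: cl_def)
    then show ?thesis using cl_eq[of i x] i by simp
  qed
  have cl_psi: "\<psi> (j, a, b) \<in> S \<and> cl (\<psi> (j, a, b)) = g (j, a)"
    if "j \<in> {1..r}" "a < h j" "b < k j" for j a b
    using memQ[OF gQ[OF that(1,2)] en_mem[OF that]] .
  have g_inj: "(j, a) = (j', a')" if "g (j, a) = g (j', a')" "j \<in> {1..r}" "a < h j" "j' \<in> {1..r}" "a' < h j'"
    for j a j' a' using inj_onD[OF bij_betw_imp_inj_on[OF g], of "(j, a)" "(j', a')"] that by simp
  have "inj_on \<psi> (cyc_index r h k)"
  proof (rule inj_onI)
    fix s t assume s: "s \<in> cyc_index r h k" "t \<in> cyc_index r h k" and "\<psi> s = \<psi> t"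
    obtain j a b j' a' b' where st: "s = (j, a, b)" "t = (j', a', b')"
      by (metis prod_cases3)
    with \<open>\<psi> s = \<psi> t\<close> have eq: "\<psi> (j, a, b) = \<psi> (j', a', b')" by simp
    have m: "j \<in> {1..r}" "a < h j" "b < k j" "j' \<in> {1..r}" "a' < h j'" "b' < k j'"
      using s st by (auto simp: cyc_index_def)
    have "g (j, a) = g (j', a')"
      using cl_psi[OF m(1-3)] cl_psi[OF m(4-6)] by (simp add: eq)
    then have ja: "(j, a) = (j', a')" using g_inj m by blast
    then have "en (g (j, a)) b = en (g (j, a)) b'" using eq by (simp add: \<psi>_def)
    then have "b = b'"
      using inj_onD[OF bij_betw_imp_inj_on[OF en[OF gQ[OF m(1,2)]]], of b b'] card_g[OF m(1,2)] m ja by simp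
    with ja st show "s = t" by simp
  qed
  moreover have "\<psi> ` cyc_index r h k = S"
  proof (intro equalityI subsetI)
    fix x assume "x \<in> S"
    then have "cl x \<in> Q" by (simp add: Q_def)
    then obtain j a where ja: "j \<in> {1..r}" "a < h j" "cl x = g (j, a)"
      using bij_betw_imp_surj_on[OF g] by auto
    have "en (g (j, a)) ` {..<k j} = g (j, a)"
      using bij_betw_imp_surj_on[OF en[OF gQ[OF ja(1,2)]]] card_g[OF ja(1,2)] by simp
    then obtain b where "b < k j" "x = en (g (j, a)) b"
      using mem_cl[OF \<open>x \<in> S\<close>] ja(3) by blast
    then show "x \<in> \<psi> ` cyc_index r h k"
      using ja by (intro image_eqI[of _ _ "(j, a, b)"]) (auto simp: \<psi>_def cyc_index_def)
  qed (use cl_psi in \<open>auto simp: cyc_index_def\<close>)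
  ultimately have bij: "bij_betw \<psi> (cyc_index r h k) S" by (simp add: bij_betw_def)
  have "d (\<psi> s) (\<psi> t) = cyc_entry h k 1 s t" if st: "s \<in> cyc_index r h k" "t \<in> cyc_index r h k" for s t
  proof -
    obtain j a b j' a' b' where s': "s = (j, a, b)" "t = (j', a', b')"
      by (metis prod_cases3)
    have m: "j \<in> {1..r}" "a < h j" "b < k j" "j' \<in> {1..r}" "a' < h j'" "b' < k j'"
      using st s' by (auto simp: cyc_index_def)
    have S: "\<psi> s \<in> S" "\<psi> t \<in> S" "cl (\<psi> s) = g (j, a)" "cl (\<psi> t) = g (j', a')"
      using cl_psi m s' by auto
    \<comment> \<open>Positivity of an entry depends on classes alone, so it translates into one
      step of \<open>T\<close> and then into one step along a cycle.\<close>
    have "0 < d (\<psi> s) (\<psi> t) \<longleftrightarrow> ou (\<psi> s) = cl (\<psi> t)"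
    proof
      assume "ou (\<psi> s) = cl (\<psi> t)"
      then have "\<psi> t \<in> ou (\<psi> s)" using mem_cl[OF S(2)] by simp
      then show "0 < d (\<psi> s) (\<psi> t)" by (simp add: ou_def)
    qed (use ou_cl S in blast)
    also have "\<dots> \<longleftrightarrow> g (j, Suc a mod h j) = g (j', a')"
      using T[of "\<psi> s"] Tg[of j a] S m by simp
    also have "\<dots> \<longleftrightarrow> j = j' \<and> a' = Suc a mod h j"
      using g_inj[of j "Suc a mod h j" j' a'] m h by auto
    finally have iff: "0 < d (\<psi> s) (\<psi> t) \<longleftrightarrow> j = j' \<and> a' = Suc a mod h j" .
    show ?thesis
    proof (cases "0 < d (\<psi> s) (\<psi> t)")
      case True
      then show ?thesis using iff val[OF True] S card_g[of j a] m s' by simp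
    next
      case False
      then have "d (\<psi> s) (\<psi> t) = 0" using nn(1)[of "\<psi> s" "\<psi> t"] S by simp
      moreover have "cyc_entry h k 1 s t = 0" using iff False s' by auto
      ultimately show ?thesis by simp
    qed
  qed
  with r h k0 bij show thesis by (intro that) auto
qed

section \<open>Block-diagonal form\<close>

text \<open>Induction over the list of blocks: rows of the first block keep their numbers, and rows
  of the others are shifted by its dimension. Keeping the coordinate map existential hides the
  partial sums of dimensions.\<close>

lemma diag_block_mat_coords:
  assumes "\<forall>A\<in>set As. square_mat A"
  shows "\<exists>\<phi>. bij_betw \<phi> (SIGMA i:{..<length As}. {..<dim_row (As ! i)}) {..<sum_list (map dim_row As)} \<and>
    (\<forall>i a i' a'. i < length As \<longrightarrow> a < dim_row (As ! i) \<longrightarrow> i' < length As \<longrightarrow> a' < dim_row (As ! i') \<longrightarrow>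
      diag_block_mat As $$ (\<phi> (i, a), \<phi> (i', a')) = (if i = i' then (As ! i) $$ (a, a') else 0))"
  using assms
proof (induction As)
  case Nil
  then show ?case by (simp add: bij_betw_def)
next
  case (Cons A As)
  define I where "I = (\<lambda>As :: 'a mat list. SIGMA i:{..<length As}. {..<dim_row (As ! i)})"
  define N where "N = sum_list (map dim_row As)"
  obtain \<phi> where bij: "bij_betw \<phi> (I As) {..<N}"
    and \<phi>: "\<And>i a i' a'. i < length As \<Longrightarrow> a < dim_row (As ! i) \<Longrightarrow> i' < length As \<Longrightarrow> a' < dim_row (As ! i') \<Longrightarrow>
      diag_block_mat As $$ (\<phi> (i, a), \<phi> (i', a')) = (if i = i' then (As ! i) $$ (a, a') else 0)"
    using Cons by (auto simp: I_def N_def)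
  have dA: "dim_col A = dim_row A" using Cons.prems by simp
  have dim: "dim_row (diag_block_mat As) = N" "dim_col (diag_block_mat As) = N"
    using diag_block_mat_square[of As] Cons.prems by (auto simp: N_def dim_diag_block_mat(1))
  have lt: "\<phi> (i, a) < N" if "i < length As" "a < dim_row (As ! i)" for i a
    using bij_betwE[OF bij] that by (auto simp: I_def)
  define \<phi>' where "\<phi>' = (\<lambda>(i, a). case i of 0 \<Rightarrow> a | Suc i \<Rightarrow> dim_row A + \<phi> (i, a))"
  have "inj_on \<phi>' (I (A # As))"
  proof (rule inj_onI, clarify)
    fix i a i' a' assume "(i, a) \<in> I (A # As)" "(i', a') \<in> I (A # As)" "\<phi>' (i, a) = \<phi>' (i', a')"
    then show "i = i' \<and> a = a'"
      using bij by (cases i; cases i') (auto simp: I_def \<phi>'_def bij_betw_def inj_on_def)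
  qed
  moreover have "\<phi>' ` I (A # As) = {..<dim_row A + N}"
  proof (intro equalityI subsetI)
    fix x assume "x \<in> \<phi>' ` I (A # As)"
    then obtain i a where "(i, a) \<in> I (A # As)" "x = \<phi>' (i, a)" by auto
    then show "x \<in> {..<dim_row A + N}"
      using lt by (cases i) (auto simp: I_def \<phi>'_def)
  next
    fix x assume x: "x \<in> {..<dim_row A + N}"
    show "x \<in> \<phi>' ` I (A # As)"
    proof (cases "x < dim_row A")
      case True
      then show ?thesis by (intro image_eqI[of _ _ "(0, x)"]) (auto simp: I_def \<phi>'_def)
    next
      case False
      then have "x - dim_row A \<in> \<phi> ` I As" using x bij by (auto simp: bij_betw_def)
      then obtain i a where "(i, a) \<in> I As" "x - dim_row A = \<phi> (i, a)" by auto
      then show ?thesis using False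
        by (intro image_eqI[of _ _ "(Suc i, a)"]) (auto simp: I_def \<phi>'_def)
    qed
  qed
  ultimately have "bij_betw \<phi>' (I (A # As)) {..<dim_row A + N}" by (simp add: bij_betw_def)
  moreover have "diag_block_mat (A # As) $$ (\<phi>' (i, a), \<phi>' (i', a')) =
      (if i = i' then ((A # As) ! i) $$ (a, a') else 0)"
    if "i < length (A # As)" "a < dim_row ((A # As) ! i)" "i' < length (A # As)" "a' < dim_row ((A # As) ! i')"
    for i a i' a'
    using that lt \<phi> dA by (cases i; cases i') (auto simp: \<phi>'_def Let_def dim)
  ultimately show ?case
    by (intro exI[of _ \<phi>']) (simp add: I_def N_def)
qed

lemma cyclic_blocks_coords:
  assumes hk: "\<forall>j\<in>{1..r}. 0 < h j \<and> 0 < k j"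
  shows "\<exists>\<phi>. cyc_coords
    (diag_block_mat (map (\<lambda>j. kronecker_mat (K_mat (h j)) (J_mat (k j))) [1..<r + 1]))
    (\<Sum>j=1..r. h j * k j) r h k \<phi>"
proof -
  define As where "As = map (\<lambda>j. kronecker_mat (K_mat (h j)) (J_mat (k j))) [1..<r + 1]"
  have len: "length As = r" by (simp add: As_def)
  have nth: "As ! i = kronecker_mat (K_mat (h (Suc i))) (J_mat (k (Suc i)))" if "i < r" for i
    using that by (simp add: As_def del: upt_Suc)
  have dim: "dim_row (As ! i) = h (Suc i) * k (Suc i)" if "i < r" for i
    using that by (simp add: nth kronecker_mat_def K_mat_def J_mat_def)
  have sq: "\<forall>A\<in>set As. square_mat A"
    by (auto simp: As_def kronecker_mat_def K_mat_def J_mat_def)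
  have "sum_list (map dim_row As) = sum_list (map (\<lambda>j. h j * k j) [1..<r + 1])"
    by (auto simp: As_def kronecker_mat_def K_mat_def J_mat_def intro!: arg_cong[of _ _ sum_list])
  also have "\<dots> = (\<Sum>j=1..r. h j * k j)"
    by (simp add: interv_sum_list_conv_sum_set_nat atLeastLessThanSuc_atLeastAtMost del: upt_Suc)
  finally have N: "sum_list (map dim_row As) = (\<Sum>j=1..r. h j * k j)" .
  obtain \<phi> where bij: "bij_betw \<phi> (SIGMA i:{..<r}. {..<dim_row (As ! i)}) {..<(\<Sum>j=1..r. h j * k j)}"
    and \<phi>: "\<And>i a i' a'. i < r \<Longrightarrow> a < dim_row (As ! i) \<Longrightarrow> i' < r \<Longrightarrow> a' < dim_row (As ! i') \<Longrightarrow>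
      diag_block_mat As $$ (\<phi> (i, a), \<phi> (i', a')) = (if i = i' then (As ! i) $$ (a, a') else 0)"
    using diag_block_mat_coords[OF sq] unfolding N len by blast
  \<comment> \<open>Cycles are numbered from 1 but list positions from 0. Row
    \<open>a * k j + b\<close> of a Kronecker block is split into \<open>a\<close> and
    \<open>b\<close> by division by \<open>k j\<close>.\<close>
  define \<chi> where "\<chi> = (\<lambda>(j, a, b). (j - 1 :: nat, a * k j + b))"
  have lt: "a * k j + b < h j * k j" if "a < h j" "b < k j" for a b j
  proof -
    have "a * k j + b < Suc a * k j" using that by simp
    also have "\<dots> \<le> h j * k j" using that by (intro mult_le_mono1) simp
    finally show ?thesis .
  qed
  have "bij_betw \<chi> (cyc_index r h k) (SIGMA i:{..<r}. {..<dim_row (As ! i)})"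
  proof (rule bij_betw_byWitness[where f' = "\<lambda>(i, c). (Suc i, c div k (Suc i), c mod k (Suc i))"])
    show "\<chi> ` cyc_index r h k \<subseteq> (SIGMA i:{..<r}. {..<dim_row (As ! i)})"
      using lt by (auto simp: \<chi>_def cyc_index_def dim)
    show "(\<lambda>(i, c). (Suc i, c div k (Suc i), c mod k (Suc i))) ` (SIGMA i:{..<r}. {..<dim_row (As ! i)})
        \<subseteq> cyc_index r h k"
      using hk by (auto simp: cyc_index_def dim less_mult_imp_div_less)
  qed (auto simp: \<chi>_def cyc_index_def)
  then have "bij_betw (\<phi> \<circ> \<chi>) (cyc_index r h k) {..<(\<Sum>j=1..r. h j * k j)}"
    using bij by (rule bij_betw_trans)
  moreover have "diag_block_mat As $$ ((\<phi> \<circ> \<chi>) s, (\<phi> \<circ> \<chi>) t) = cyc_entry h k 1 s t"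
    if st: "s \<in> cyc_index r h k" "t \<in> cyc_index r h k" for s t
  proof -
    obtain j a b j' a' b' where s': "s = (j, a, b)" "t = (j', a', b')"
      by (metis prod_cases3)
    have m: "j \<in> {1..r}" "a < h j" "b < k j" "j' \<in> {1..r}" "a' < h j'" "b' < k j'"
      using st s' by (auto simp: cyc_index_def)
    obtain i i' where ii: "j = Suc i" "j' = Suc i'" "i < r" "i' < r"
      using m by (cases j; cases j') auto
    have "diag_block_mat As $$ ((\<phi> \<circ> \<chi>) s, (\<phi> \<circ> \<chi>) t) =
        (if i = i' then (As ! i) $$ (a * k j + b, a' * k j' + b') else 0)"
      using m lt[of a j b] lt[of a' j' b'] by (simp add: s' ii \<chi>_def \<phi> dim)
    also have "\<dots> = cyc_entry h k 1 s t"
      using m lt[of a j b] lt[of a' j' b']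
      by (auto simp: s' ii nth kronecker_mat_def K_mat_def J_mat_def)
    finally show ?thesis .
  qed
  ultimately show ?thesis unfolding cyc_coords_def As_def[symmetric] by blast
qed

text \<open>Since \<open>P\<close> has its ones at \<open>(i, \<sigma> i)\<close>, conjugation moves
  entry \<open>(i, j)\<close> of \<open>D\<close> to the image position. Evaluating at images of
  \<open>\<sigma>\<close> avoids its inverse.\<close>

lemma permutation_conjugate_entry:
  assumes D: "D \<in> carrier_mat n n" and \<sigma>: "\<sigma> permutes {..<n}"
    and P: "P = mat n n (\<lambda>(i, j). if j = \<sigma> i then 1 else 0)" and ij: "i < n" "j < n"
  shows "(transpose_mat P * D * P) $$ (\<sigma> i, \<sigma> j) = (D $$ (i, j) :: real)"
proof -
  have Pc: "P \<in> carrier_mat n n" and Pt: "transpose_mat P \<in> carrier_mat n n"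
    by (simp_all add: P)
  have lt: "\<sigma> i < n" if "i < n" for i
    using permutes_in_image[OF \<sigma>, of i] that by simp
  have inj: "\<sigma> a = \<sigma> b \<longleftrightarrow> a = b" for a b
    using permutes_inj[OF \<sigma>] by (auto simp: inj_def)
  have P\<sigma>: "P $$ (b, \<sigma> c) = (if b = c then 1 else 0)" if "b < n" "c < n" for b c
    using that lt[of c] by (auto simp: P inj)
  have 1: "(transpose_mat P * D) $$ (\<sigma> i, b) = D $$ (i, b)" if "b < n" for b
  proof -
    have "(transpose_mat P * D) $$ (\<sigma> i, b) = (\<Sum>a<n. if a = i then D $$ (i, b) else 0)"
      unfolding mult_mat_entry[OF Pt D lt[OF ij(1)] that]
      by (intro sum.cong) (use lt[OF ij(1)] ij Pc in \<open>auto simp: P\<sigma>\<close>)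
    then show ?thesis using ij by simp
  qed
  have "(transpose_mat P * D * P) $$ (\<sigma> i, \<sigma> j) = (\<Sum>b<n. if b = j then D $$ (i, j) else 0)"
    unfolding mult_mat_entry[OF mult_carrier_mat[OF Pt D] Pc lt[OF ij(1)] lt[OF ij(2)]]
    by (intro sum.cong) (use ij in \<open>auto simp: P\<sigma> 1 simp del: index_mult_mat\<close>)
  then show ?thesis using ij by simp
qed

text \<open>With \<open>\<phi>\<close> the coordinates of the block matrix itself, coordinates
  \<open>\<psi>\<close> for \<open>D\<close> and permutations \<open>\<sigma>\<close> determine each
  other through \<open>\<sigma> \<circ> \<psi> = \<phi>\<close>. The dimension equation holds
  because \<open>\<psi>\<close> is a bijection, which fixes the number of triples.\<close>

lemma ex_cyclic_block_form_iff:
  assumes D: "D \<in> carrier_mat n n"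
  shows "(\<exists>P. cyclic_block_form n D p P r h k) \<longleftrightarrow>
    0 < r \<and> (\<forall>j\<in>{1..r}. 0 < h j \<and> 0 < k j) \<and> p = Lcm (h ` {1..r}) \<and> (\<exists>\<psi>. cyc_coords D n r h k \<psi>)"
    (is "?L \<longleftrightarrow> ?R")
proof -
  let ?I = "cyc_index r h k"
  let ?B = "diag_block_mat (map (\<lambda>j. kronecker_mat (K_mat (h j)) (J_mat (k j))) [1..<r + 1])"
  show ?thesis
  proof
    assume ?L
    then obtain P where P: "cyclic_block_form n D p P r h k" by blast
    then obtain \<sigma> where \<sigma>: "\<sigma> permutes {..<n}" and P_eq: "P = mat n n (\<lambda>(i, j). if j = \<sigma> i then 1 else 0)"
      by (auto simp: cyclic_block_form_def permutation_mat_def)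
    have B: "transpose_mat P * D * P = ?B" and n: "(\<Sum>j=1..r. h j * k j) = n"
      and hk: "\<forall>j\<in>{1..r}. 0 < h j \<and> 0 < k j"
      using P unfolding cyclic_block_form_def by blast+
    obtain \<phi> where \<phi>: "cyc_coords ?B n r h k \<phi>"
      using cyclic_blocks_coords[OF hk] unfolding n by blast
    then have bij: "bij_betw \<phi> ?I {..<n}" by (simp add: cyc_coords_def)
    have inv: "bij_betw (inv_into UNIV \<sigma>) {..<n} {..<n}"
      by (rule permutes_imp_bij[OF permutes_inv[OF \<sigma>]])
    have "D $$ ((inv_into UNIV \<sigma> \<circ> \<phi>) s, (inv_into UNIV \<sigma> \<circ> \<phi>) t) = cyc_entry h k 1 s t" if "s \<in> ?I" "t \<in> ?I" for s t
    proof -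
      have lt: "inv_into UNIV \<sigma> (\<phi> s) < n" "inv_into UNIV \<sigma> (\<phi> t) < n"
        using bij_betwE[OF bij] bij_betwE[OF inv] that by auto
      show ?thesis
        using permutation_conjugate_entry[OF D \<sigma> P_eq lt] \<phi> that
        by (simp add: B permutes_inverses[OF \<sigma>] cyc_coords_def del: upt_Suc diag_block_mat.simps)
    qed
    moreover have "bij_betw (inv_into UNIV \<sigma> \<circ> \<phi>) ?I {..<n}" using bij inv by (rule bij_betw_trans)
    ultimately have "cyc_coords D n r h k (inv_into UNIV \<sigma> \<circ> \<phi>)" by (simp add: cyc_coords_def)
    then show ?R using P by (auto simp: cyclic_block_form_def)
  next
    assume R: ?R
    then obtain \<psi> where \<psi>: "cyc_coords D n r h k \<psi>" by blast
    then have bij: "bij_betw \<psi> ?I {..<n}" by (simp add: cyc_coords_def)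
    have n: "(\<Sum>j=1..r. h j * k j) = n"
      using bij_betw_same_card[OF bij] by (simp add: cyc_index_def)
    have hk: "\<forall>j\<in>{1..r}. 0 < h j \<and> 0 < k j" using R by blast
    obtain \<phi> where \<phi>: "cyc_coords ?B n r h k \<phi>"
      using cyclic_blocks_coords[OF hk] unfolding n by blast
    then have bij': "bij_betw \<phi> ?I {..<n}" by (simp add: cyc_coords_def)
    \<comment> \<open>Sends the row of \<open>D\<close> with given block coordinates to the row of
      the block matrix with the same coordinates, and fixes everything from \<open>n\<close>
      on.\<close>
    define \<sigma> where "\<sigma> x = (if x \<in> {..<n} then \<phi> (inv_into ?I \<psi> x) else x)" for x
    have "bij_betw (\<phi> \<circ> inv_into ?I \<psi>) {..<n} {..<n}"
      using bij_betw_inv_into[OF bij] bij' by (rule bij_betw_trans)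
    then have "bij_betw \<sigma> {..<n} {..<n}"
      by (rule bij_betw_cong[THEN iffD1, rotated]) (simp add: \<sigma>_def)
    then have \<sigma>: "\<sigma> permutes {..<n}" by (rule bij_imp_permutes) (simp add: \<sigma>_def)
    have \<sigma>\<psi>: "\<sigma> (\<psi> s) = \<phi> s" "\<psi> s < n" if "s \<in> ?I" for s
      using bij_betwE[OF bij] bij_betw_inv_into_left[OF bij] that by (auto simp: \<sigma>_def)
    define P :: "real mat" where "P = mat n n (\<lambda>(i, j). if j = \<sigma> i then 1 else 0)"
    have surj: "\<exists>s\<in>?I. x = \<phi> s" if "x < n" for x
      using bij_betw_imp_surj_on[OF bij'] that by blast
    have "transpose_mat P * D * P = ?B"
    proof (rule eq_matI)
      fix x y assume "x < dim_row ?B" "y < dim_col ?B"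
      moreover have "dim_row ?B = n" "dim_col ?B = n"
        by (simp_all add: dim_diag_block_mat o_def kronecker_mat_def K_mat_def J_mat_def
            interv_sum_list_conv_sum_set_nat atLeastLessThanSuc_atLeastAtMost n[simplified] del: upt_Suc)
      ultimately obtain s t where st: "s \<in> ?I" "t \<in> ?I" "x = \<phi> s" "y = \<phi> t"
        using surj by metis
      then show "(transpose_mat P * D * P) $$ (x, y) = ?B $$ (x, y)"
        using permutation_conjugate_entry[OF D \<sigma> P_def \<sigma>\<psi>(2) \<sigma>\<psi>(2), of s t] \<phi> \<psi>
        by (simp add: \<sigma>\<psi>(1) cyc_coords_def del: upt_Suc)
    qed (simp_all add: P_def dim_diag_block_mat o_def kronecker_mat_def K_mat_def J_mat_def
            interv_sum_list_conv_sum_set_nat atLeastLessThanSuc_atLeastAtMost n[simplified] del: upt_Suc)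
    then have "cyclic_block_form n D p P r h k"
      using R n \<sigma> unfolding cyclic_block_form_def permutation_mat_def P_def by blast
    then show ?L ..
  qed
qed

section \<open>Cyclic doubly stochastic matrices\<close>

lemma doubly_stochastic_iff_bistochastic_on:
  assumes "D \<in> carrier_mat n n"
  shows "doubly_stochastic D \<longleftrightarrow> bistochastic_on {..<n} (\<lambda>i j. D $$ (i, j))"
  using assms by (auto simp: doubly_stochastic_def bistochastic_on_def)

lemma bistochastic_on_mult:
  assumes A: "A \<in> carrier_mat n n" "bistochastic_on {..<n} (\<lambda>i j. A $$ (i, j))"
    and B: "B \<in> carrier_mat n n" "bistochastic_on {..<n} (\<lambda>i j. B $$ (i, j))"
  shows "bistochastic_on {..<n} (\<lambda>i j. (A * B) $$ (i, j))"
proof -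
  have e: "(A * B) $$ (i, j) = (\<Sum>k<n. A $$ (i, k) * B $$ (k, j))" if "i < n" "j < n" for i j
    using mult_mat_entry A(1) B(1) that .
  have "(\<Sum>j<n. (A * B) $$ (i, j)) = 1" if "i < n" for i
  proof -
    have "(\<Sum>j<n. (A * B) $$ (i, j)) = (\<Sum>k<n. A $$ (i, k) * (\<Sum>j<n. B $$ (k, j)))"
      using that by (simp add: e sum_distrib_left del: index_mult_mat) (rule sum.swap)
    then show ?thesis using A(2) B(2) that by (simp add: bistochastic_on_def)
  qed
  moreover have "(\<Sum>i<n. (A * B) $$ (i, j)) = 1" if "j < n" for j
  proof -
    have "(\<Sum>i<n. (A * B) $$ (i, j)) = (\<Sum>k<n. (\<Sum>i<n. A $$ (i, k)) * B $$ (k, j))"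
      using that by (simp add: e sum_distrib_right del: index_mult_mat) (rule sum.swap)
    then show ?thesis using A(2) B(2) that by (simp add: bistochastic_on_def)
  qed
  moreover have "0 \<le> (A * B) $$ (i, j)" if "i < n" "j < n" for i j
    using A(2) B(2) that unfolding e[OF that] bistochastic_on_def by (auto intro!: sum_nonneg)
  ultimately show ?thesis unfolding bistochastic_on_def by blast
qed

lemma bistochastic_on_pow:
  assumes D: "D \<in> carrier_mat n n" "bistochastic_on {..<n} (\<lambda>i j. D $$ (i, j))"
  shows "bistochastic_on {..<n} (\<lambda>i j. (D ^\<^sub>m Suc m) $$ (i, j))"
proof (induction m)
  case 0
  have "D ^\<^sub>m Suc 0 = D" using D by simp
  then show ?case using D by simp
next
  case (Suc m)
  show ?case
    using bistochastic_on_mult[OF pow_carrier_mat[OF D(1)] Suc D] by simp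
qed

lemma pow_mat_add_exp:
  assumes "A \<in> carrier_mat n n"
  shows "A ^\<^sub>m (l + m) = A ^\<^sub>m l * A ^\<^sub>m m"
proof (induction m)
  case (Suc m)
  then show ?case
    using assms by (simp add: assoc_mult_mat[of _ n n _ n _ n])
qed (use assms in simp)

text \<open>Applies the cycle structure with \<open>d\<close>, \<open>e\<close> and
  \<open>d'\<close> the powers of \<open>D\<close> with exponents 1, \<open>p\<close> and
  \<open>2 * p - 1\<close>.\<close>

lemma cyclic_imp_cyc_coords:
  assumes "0 < n" and D: "D \<in> carrier_mat n n" and ds: "doubly_stochastic D"
    and p: "0 < p" and cyc: "D ^\<^sub>m (p + 1) = D"
  obtains r h k \<psi> where "0 < r" "\<forall>j\<in>{1..r}. 0 < h j \<and> 0 < k j" "cyc_coords D n r h k \<psi>"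
proof -
  obtain q where q: "p = Suc q" using p gr0_implies_Suc by blast
  \<comment> \<open>Exponents reduce modulo \<open>p\<close> only while they stay positive:
    \<open>D ^ p\<close> is an idempotent, not necessarily the identity.\<close>
  have red: "D ^\<^sub>m (Suc m + p) = D ^\<^sub>m Suc m" for m
    using pow_mat_add_exp[OF D, of m "p + 1"] pow_mat_add_exp[OF D, of m 1] D cyc by simp
  have one: "D ^\<^sub>m Suc 0 = D" using D by simp
  have comp: "(\<Sum>k<n. (D ^\<^sub>m a) $$ (i, k) * (D ^\<^sub>m b) $$ (k, j)) = (D ^\<^sub>m (a + b)) $$ (i, j)"
    if "i \<in> {..<n}" "j \<in> {..<n}" for a b i j
    using mult_mat_entry[OF pow_carrier_mat[OF D] pow_carrier_mat[OF D], of i j a b] that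
    by (simp add: pow_mat_add_exp[OF D])
  have bi: "bistochastic_on {..<n} (\<lambda>i j. (D ^\<^sub>m Suc m) $$ (i, j))" for m
    using bistochastic_on_pow D ds doubly_stochastic_iff_bistochastic_on by blast
  have "{..<n} \<noteq> {}" using \<open>0 < n\<close> by auto
  then obtain r h k \<psi> where "0 < r" "\<forall>j\<in>{1..r}. 0 < h j \<and> 0 < k j"
    and "bij_betw \<psi> (cyc_index r h k) {..<n}"
    and "\<forall>s\<in>cyc_index r h k. \<forall>t\<in>cyc_index r h k. (D ^\<^sub>m Suc 0) $$ (\<psi> s, \<psi> t) = cyc_entry h k 1 s t"
  proof (rule bistochastic_cycle_structure[OF finite_lessThan _ bi[of 0] bi[of "q + q"] bi[of q]])
    \<comment> \<open>With \<open>p = Suc q\<close>, the inverse exponent \<open>2 * p - 1\<close>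
      is \<open>Suc (q + q)\<close>. Each sum of exponents is written as a positive exponent plus
      \<open>p\<close> so that \<open>red\<close> applies.\<close>
    have eqs: "Suc q + Suc q = Suc q + p" "Suc q + Suc 0 = Suc 0 + p" "Suc 0 + Suc q = Suc 0 + p"
      "Suc 0 + Suc (q + q) = (Suc q + p)" "Suc (q + q) + Suc 0 = (Suc q + p)"
      by (simp_all add: q)
    fix i j assume ij: "i \<in> {..<n}" "j \<in> {..<n}"
    note c = comp[OF ij]
    show "(\<Sum>k<n. (D ^\<^sub>m Suc q) $$ (i, k) * (D ^\<^sub>m Suc q) $$ (k, j)) = (D ^\<^sub>m Suc q) $$ (i, j)"
      "(\<Sum>k<n. (D ^\<^sub>m Suc q) $$ (i, k) * (D ^\<^sub>m Suc 0) $$ (k, j)) = (D ^\<^sub>m Suc 0) $$ (i, j)"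
      "(\<Sum>k<n. (D ^\<^sub>m Suc 0) $$ (i, k) * (D ^\<^sub>m Suc q) $$ (k, j)) = (D ^\<^sub>m Suc 0) $$ (i, j)"
      "(\<Sum>k<n. (D ^\<^sub>m Suc 0) $$ (i, k) * (D ^\<^sub>m Suc (q + q)) $$ (k, j)) = (D ^\<^sub>m Suc q) $$ (i, j)"
      "(\<Sum>k<n. (D ^\<^sub>m Suc (q + q)) $$ (i, k) * (D ^\<^sub>m Suc 0) $$ (k, j)) = (D ^\<^sub>m Suc q) $$ (i, j)"
      unfolding c eqs red by (rule refl)+
  qed (rule that; assumption)
  then show thesis by (intro that[of r h k \<psi>]) (simp_all add: cyc_coords_def one del: pow_mat.simps One_nat_def)
qed

text \<open>Over a full period each cycle contributes \<open>p\<close> to the sum of traces, so the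
  multiplicity of 1 is the number of cycles. In \<open>D ^ p\<close> every shift is trivial, so its
  trace is the sum of all cycle lengths.\<close>

lemma cyc_coords_multiplicities:
  assumes D: "D \<in> carrier_mat n n" and c: "cyc_coords D n r h k \<psi>"
    and h: "\<forall>j\<in>{1..r}. 0 < h j \<and> 0 < k j" and r: "0 < r"
  shows "alg_multiplicity (map_mat complex_of_real D) 1 = r"
    and "num_peripheral_eigenvalues (map_mat complex_of_real D) = (\<Sum>j=1..r. h j)"
proof -
  let ?A = "map_mat complex_of_real D"
  define p where "p = Lcm (h ` {1..r})"
  have p: "0 < p"
    using h by (fastforce simp: p_def Lcm_0_iff intro!: gr0I)
  have hp: "h j dvd p" if "j \<in> {1..r}" for j
    using that by (simp add: p_def dvd_Lcm)
  have A: "?A \<in> carrier_mat n n" using D by simp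
  have pow: "?A ^\<^sub>m m = map_mat complex_of_real (D ^\<^sub>m m)" for m
    by (rule of_real_hom.mat_hom_pow[OF D, symmetric])
  have cyc: "?A ^\<^sub>m (p + 1) = ?A"
    using cyc_coords_pow_eq_iff[OF D c h, of p] by (simp only: pow p_def dvd_refl simp_thms)
  have tr: "mat_trace (?A ^\<^sub>m m) = complex_of_real (\<Sum>j=1..r. if h j dvd m then real (h j) else 0)" if "0 < m" for m
    using cyc_coords_trace[OF D c h that] D by (simp add: pow mat_trace_def flip: of_real_sum)
  \<comment> \<open>Between 1 and \<open>p\<close> there are \<open>p / h j\<close> multiples of
    \<open>h j\<close>, each weighted by \<open>h j\<close>.\<close>
  have count: "(\<Sum>m=1..p. if h j dvd m then real (h j) else 0) = real p" if "j \<in> {1..r}" for j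
  proof -
    obtain q where q: "p = h j * q" using hp[OF \<open>j \<in> {1..r}\<close>] by (blast elim: dvdE)
    have h0: "0 < h j" using h that by blast
    have "bij_betw (\<lambda>i. h j * i) {1..q} {m \<in> {1..p}. h j dvd m}"
      using h0 by (intro bij_betw_byWitness[where f' = "\<lambda>m. m div h j"]) (auto simp: q)
    then have "card {m \<in> {1..p}. h j dvd m} = q"
      using bij_betw_same_card by fastforce
    then show ?thesis by (simp add: sum.If_cases Int_def q)
  qed
  have "of_nat (p * alg_multiplicity ?A 1) =
      complex_of_real (\<Sum>m=1..p. \<Sum>j=1..r. if h j dvd m then real (h j) else 0)"
    unfolding multiplicities_of_power_idempotent(1)[OF A p cyc] of_real_sum[of _ "{1..p}"]
    by (intro sum.cong refl tr) simp
  also have "(\<Sum>m=1..p. \<Sum>j=1..r. if h j dvd m then real (h j) else 0) = (\<Sum>j=1..r. real p)"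
    by (subst sum.swap) (intro sum.cong refl count)
  also have "complex_of_real \<dots> = of_nat (p * r)" by simp
  finally show m: "alg_multiplicity ?A 1 = r"
    using p by (simp only: of_nat_eq_iff) simp
  have "of_nat (num_peripheral_eigenvalues ?A) = mat_trace (?A ^\<^sub>m p)"
    using multiplicities_of_power_idempotent(2)[OF A p cyc] m r by simp
  also have "\<dots> = of_nat (\<Sum>j=1..r. h j)"
    unfolding tr[OF p] using hp by simp
  finally show "num_peripheral_eigenvalues ?A = (\<Sum>j=1..r. h j)"
    by (simp only: of_nat_eq_iff)
qed

text \<open>The valid periods are the positive multiples of the least common multiple, and the order
  is the smallest of them.\<close>

lemma cyc_coords_cyclic_of_order_iff:
  assumes D: "D \<in> carrier_mat n n" and c: "cyc_coords D n r h k \<psi>"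
    and h: "\<forall>j\<in>{1..r}. 0 < h j \<and> 0 < k j"
  shows "cyclic_of_order D p \<longleftrightarrow> p = Lcm (h ` {1..r})"
proof -
  let ?L = "Lcm (h ` {1..r})"
  have L: "0 < ?L" using h by (fastforce simp: Lcm_0_iff intro!: gr0I)
  have "cyclic_of_order D p \<longleftrightarrow> 0 < p \<and> ?L dvd p \<and> (\<forall>m. 1 \<le> m \<and> m < p \<longrightarrow> \<not> ?L dvd m)"
    using D unfolding cyclic_of_order_def cyc_coords_pow_eq_iff[OF D c h] by auto
  also have "\<dots> \<longleftrightarrow> p = ?L"
  proof
    assume *: "0 < p \<and> ?L dvd p \<and> (\<forall>m. 1 \<le> m \<and> m < p \<longrightarrow> \<not> ?L dvd m)"
    then have "?L \<le> p" by (simp add: dvd_imp_le)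
    moreover have "\<not> ?L < p" using * L by (metis One_nat_def Suc_leI dvd_refl)
    ultimately show "p = ?L" by simp
  qed (use L in \<open>auto dest: dvd_imp_le\<close>)
  finally show ?thesis .
qed

theorem theorem4p12:
  fixes D :: "real mat" and n p :: nat
  assumes "0 < n" and "D \<in> carrier_mat n n" and "doubly_stochastic D" and "0 < p"
  shows "(cyclic_of_order D p \<longleftrightarrow> (\<exists>P r h k. cyclic_block_form n D p P r h k)) \<and>
    (\<forall>P r h k. cyclic_block_form n D p P r h k \<longrightarrow>
       alg_multiplicity (map_mat complex_of_real D) 1 = r \<and>
       num_peripheral_eigenvalues (map_mat complex_of_real D) = (\<Sum>i=1..r. h i))"
proof (intro conjI iffI allI impI)
  note D = assms(2) and block_iff = ex_cyclic_block_form_iff[OF assms(2)]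
  {
    assume cyc: "cyclic_of_order D p"
    then have "D ^\<^sub>m (p + 1) = D" by (simp add: cyclic_of_order_def)
    then obtain r h k \<psi> where r: "0 < r" and h: "\<forall>j\<in>{1..r}. 0 < h j \<and> 0 < k j"
      and c: "cyc_coords D n r h k \<psi>"
      using cyclic_imp_cyc_coords[OF assms] by blast
    have "p = Lcm (h ` {1..r})"
      using cyc cyc_coords_cyclic_of_order_iff[OF D c h] by simp
    with r h c show "\<exists>P r h k. cyclic_block_form n D p P r h k"
      using block_iff by blast
  next
    assume "\<exists>P r h k. cyclic_block_form n D p P r h k"
    then show "cyclic_of_order D p"
      using block_iff cyc_coords_cyclic_of_order_iff[OF D] by metis
  next
    fix P r h k assume "cyclic_block_form n D p P r h k"
    then show "alg_multiplicity (map_mat complex_of_real D) 1 = r"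
      "num_peripheral_eigenvalues (map_mat complex_of_real D) = (\<Sum>i=1..r. h i)"
      using block_iff cyc_coords_multiplicities[OF D] by metis+
  }
qed

end
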